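(* Let $\alpha(u)=(u,f_1(u),f_2(u))$ be a smooth space curve in the Galilean space $\mathbb{G}_3$ and let $\beta(v)=(0,g_1(v),g_2(v))$ be a smooth isotropic curve with $(g_1')^2+(g_2')^2=1$, both defined on open intervals. If the translation surface $$r(u,v)=\alpha(u)+\beta(v)=\bigl(u,\;f_1(u)+g_1(v),\;f_2(u)+g_2(v)\bigr)$$ has constant mean curvature $H_0$, then either (1) $H_0=0$ and the surface is a generalized cylinder with isotropic rulings; or (2) $H_0\neq 0$ and the translating isotropic curve $\beta$ is (an arc of) a Euclidean circle with radius $\frac{1}{|H_0|}$.
   Context: The affine model of the Galilean 3-space $\mathbb{G}_3$ is $\mathbb{R}^3$ with coordinates $(x,y,z)$. A vector is isotropic if its first component is $0$; planes $x=\text{const}$ are Euclidean planes, carrying the Euclidean metric in $(y,z)$. A curve $\alpha(u)=(u,f_1(u),f_2(u))$ is a space curve if its torsion is nowhere zero, i.e. $f_1''f_2'''-f_1'''f_2''\neq 0$ at every $u$. Curvatures of a surface $r(u_1,u_2)=(x,y,z)$ (with $x_{,i}=\partial x/\partial u_i$, $x_{,ij}=\partial^2x/\partial u_i\partial u_j$, etc.): assume $x_{,i}\ne 0$ for some $i$ at each point (admissibility), and set $$W=\sqrt{(x_{,1}z_{,2}-x_{,2}z_{,1})^2+(x_{,2}y_{,1}-x_{,1}y_{,2})^2}>0,\qquad N=\tfrac1W\bigl(0,\,-x_{,1}z_{,2}+x_{,2}z_{,1},\,x_{,1}y_{,2}-x_{,2}y_{,1}\bigr),$$ $$L_{ij}=\tfrac1{x_{,k}}\bigl(x_{,k}(0,y_{,ij},z_{,ij})-x_{,ij}(0,y_{,k},z_{,k})\bigr)\cdot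 N$$ for an index $k$ with $x_{,k}\neq 0$, where $\cdot$ is the Euclidean scalar product. The mean curvature is normalized as $H=(x_{,2}^2L_{11}-2x_{,1}x_{,2}L_{12}+x_{,1}^2L_{22})/W^2$. A generalized cylinder (cylindrical surface) is a surface that can be parameterized as $\gamma(t)+\lambda e$ with $\gamma$ a curve and $e\neq 0$ a constant vector; its rulings are isotropic if $e$ is isotropic. *)

theory Defs
  imports "HOL-Analysis.Analysis"
begin

definition open_interval :: "real set \<Rightarrow> bool" where
  "open_interval I \<longleftrightarrow> open I \<and> is_interval I \<and> I \<noteq> {}"

definition smooth_fun_on :: "real set \<Rightarrow> (real \<Rightarrow> real) \<Rightarrow> bool" where
  "smooth_fun_on I f \<longleftrightarrow> (\<forall>n. \<forall>t\<in>I. ((deriv ^^ n) f) differentiable (at t))"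

definition smooth_curve_on :: "real set \<Rightarrow> (real \<Rightarrow> real ^ 3) \<Rightarrow> bool" where
  "smooth_curve_on I c \<longleftrightarrow> (\<forall>i. smooth_fun_on I (\<lambda>t. c t $ i))"

definition isotropic :: "real ^ 3 \<Rightarrow> bool" where
  "isotropic p \<longleftrightarrow> p $ 1 = 0"

definition graph_curve :: "(real \<Rightarrow> real) \<Rightarrow> (real \<Rightarrow> real) \<Rightarrow> real \<Rightarrow> real ^ 3" where
  "graph_curve f1 f2 u = vector [u, f1 u, f2 u]"

definition isotropic_curve :: "(real \<Rightarrow> real) \<Rightarrow> (real \<Rightarrow> real) \<Rightarrow> real \<Rightarrow> real ^ 3" where
  "isotropic_curve g1 g2 v = vector [0, g1 v, g2 v]"

text \<open>The curve \<open>graph_curve f1 f2\<close> is a space curve on \<open>I\<close>: its torsion vanishes nowhere.\<close>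

definition space_curve_on :: "real set \<Rightarrow> (real \<Rightarrow> real) \<Rightarrow> (real \<Rightarrow> real) \<Rightarrow> bool" where
  "space_curve_on I f1 f2 \<longleftrightarrow>
     (\<forall>u\<in>I. (deriv ^^ 2) f1 u * (deriv ^^ 3) f2 u - (deriv ^^ 3) f1 u * (deriv ^^ 2) f2 u \<noteq> 0)"

definition translation_surface ::
    "(real \<Rightarrow> real ^ 3) \<Rightarrow> (real \<Rightarrow> real ^ 3) \<Rightarrow> real \<Rightarrow> real \<Rightarrow> real ^ 3" where
  "translation_surface a b u v = a u + b v"

text \<open>A parametrised surface is a map \<open>r u v\<close> with two real parameters, numbered by the two
  elements \<open>1, 2\<close> of the index type \<open>2\<close>.\<close>

definition partial :: "2 \<Rightarrow> (real \<Rightarrow> real \<Rightarrow> real) \<Rightarrow> real \<Rightarrow> real \<Rightarrow> real" where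
  "partial i h u v = (if i = 1 then deriv (\<lambda>s. h s v) u else deriv (\<lambda>t. h u t) v)"

text \<open>\<open>D1 r m i\<close> and \<open>D2 r m i j\<close> are the first and second partial derivatives of the
  coordinate \<open>m\<close> of \<open>r\<close>, where coordinates \<open>1, 2, 3\<close> are \<open>x, y, z\<close>.\<close>

definition D1 :: "(real \<Rightarrow> real \<Rightarrow> real ^ 3) \<Rightarrow> 3 \<Rightarrow> 2 \<Rightarrow> real \<Rightarrow> real \<Rightarrow> real" where
  "D1 r m i = partial i (\<lambda>u v. r u v $ m)"

definition D2 :: "(real \<Rightarrow> real \<Rightarrow> real ^ 3) \<Rightarrow> 3 \<Rightarrow> 2 \<Rightarrow> 2 \<Rightarrow> real \<Rightarrow> real \<Rightarrow> real" where
  "D2 r m i j = partial i (partial j (\<lambda>u v. r u v $ m))"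

definition surface_W :: "(real \<Rightarrow> real \<Rightarrow> real ^ 3) \<Rightarrow> real \<Rightarrow> real \<Rightarrow> real" where
  "surface_W r u v =
     sqrt ((D1 r 1 1 u v * D1 r 3 2 u v - D1 r 1 2 u v * D1 r 3 1 u v)\<^sup>2
         + (D1 r 1 2 u v * D1 r 2 1 u v - D1 r 1 1 u v * D1 r 2 2 u v)\<^sup>2)"

definition surface_N :: "(real \<Rightarrow> real \<Rightarrow> real ^ 3) \<Rightarrow> real \<Rightarrow> real \<Rightarrow> real ^ 3" where
  "surface_N r u v = (1 / surface_W r u v) *\<^sub>R
     vector [0,
             - (D1 r 1 1 u v * D1 r 3 2 u v) + D1 r 1 2 u v * D1 r 3 1 u v,
             D1 r 1 1 u v * D1 r 2 2 u v - D1 r 1 2 u v * D1 r 2 1 u v]"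

definition surface_L_wrt ::
    "2 \<Rightarrow> (real \<Rightarrow> real \<Rightarrow> real ^ 3) \<Rightarrow> 2 \<Rightarrow> 2 \<Rightarrow> real \<Rightarrow> real \<Rightarrow> real" where
  "surface_L_wrt k r i j u v =
     (1 / D1 r 1 k u v) *
     ((D1 r 1 k u v *\<^sub>R (vector [0, D2 r 2 i j u v, D2 r 3 i j u v] :: real ^ 3)
       - D2 r 1 i j u v *\<^sub>R vector [0, D1 r 2 k u v, D1 r 3 k u v])
      \<bullet> surface_N r u v)"

text \<open>The choice of \<open>k\<close> is immaterial; see \<open>surface_L_wrt_eq\<close> below. At points where no such
  \<open>k\<close> exists (non-admissible points) the value is irrelevant.\<close>

definition surface_L ::
    "(real \<Rightarrow> real \<Rightarrow> real ^ 3) \<Rightarrow> 2 \<Rightarrow> 2 \<Rightarrow> real \<Rightarrow> real \<Rightarrow> real" where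
  "surface_L r i j u v = surface_L_wrt (SOME k. D1 r 1 k u v \<noteq> 0) r i j u v"

lemma surface_L_wrt_eq:
  assumes "D1 r 1 k u v \<noteq> 0" "D1 r 1 l u v \<noteq> 0"
  shows "surface_L_wrt k r i j u v = surface_L_wrt l r i j u v"
proof -
  have *: "surface_L_wrt 1 r i j u v = surface_L_wrt 2 r i j u v"
    if "D1 r 1 1 u v \<noteq> 0" "D1 r 1 2 u v \<noteq> 0"
  proof -
    have eq: "(1 / a) * ((a * p - w * c) * (n * (b * h - a * d)) + (a * q - w * h) * (n * (a * f - b * c)))
      = (1 / b) * ((b * p - w * f) * (n * (b * h - a * d)) + (b * q - w * d) * (n * (a * f - b * c)))"
      if "a \<noteq> 0" "b \<noteq> 0" for a b c d f h n p q w :: real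
    proof -
      have *: "b * ((a * p - w * c) * (n * (b * h - a * d)) + (a * q - w * h) * (n * (a * f - b * c)))
        = a * ((b * p - w * f) * (n * (b * h - a * d)) + (b * q - w * d) * (n * (a * f - b * c)))"
      proof -
        have "c * (b * h - a * d) * b + h * (a * f - b * c) * b
          = f * (b * h - a * d) * a + d * (a * f - b * c) * a"
          by (simp only: algebra_simps)
        then have "w * n * (c * (b * h - a * d) * b + h * (a * f - b * c) * b)
          = w * n * (f * (b * h - a * d) * a + d * (a * f - b * c) * a)"
          by (rule arg_cong)
        then show ?thesis
          by (simp only: algebra_simps)
      qed
      have "b * A = a * B \<Longrightarrow> (1 / a) * A = (1 / b) * B" for A B
        using that by (simp add: frac_eq_eq mult.commute)
      with * show ?thesis by blast
    qed
    show ?thesis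
      using eq[OF that, of "D2 r 2 i j u v" "D2 r 1 i j u v" "D1 r 2 1 u v" "1 / surface_W r u v"
          "D1 r 3 1 u v" "D1 r 3 2 u v" "D2 r 3 i j u v" "D1 r 2 2 u v"]
      unfolding surface_L_wrt_def surface_N_def inner_vec_def sum_3 vector_scaleR_component
        vector_minus_component vector_3 real_scaleR_def inner_real_def
      by (simp only: mult_zero_right mult_zero_left diff_0_right add_0_left uminus_add_conv_diff)
  qed
  show ?thesis
  proof (cases "k = l")
    case False
    then consider "k = 1" "l = 2" | "k = 2" "l = 1"
      using exhaust_2[of k] exhaust_2[of l] by auto
    then show ?thesis
      using * assms by cases simp_all
  qed simp
qed

lemma surface_L_eq:
  assumes "D1 r 1 k u v \<noteq> 0"
  shows "surface_L r i j u v = surface_L_wrt k r i j u v"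
proof -
  have "D1 r 1 (SOME l. D1 r 1 l u v \<noteq> 0) u v \<noteq> 0"
    using someI[of "\<lambda>l. D1 r 1 l u v \<noteq> 0", OF assms] .
  from surface_L_wrt_eq[OF this assms] show ?thesis
    by (simp only: surface_L_def)
qed

definition mean_curvature :: "(real \<Rightarrow> real \<Rightarrow> real ^ 3) \<Rightarrow> real \<Rightarrow> real \<Rightarrow> real" where
  "mean_curvature r u v =
     ((D1 r 1 2 u v)\<^sup>2 * surface_L r 1 1 u v
      - 2 * D1 r 1 1 u v * D1 r 1 2 u v * surface_L r 1 2 u v
      + (D1 r 1 1 u v)\<^sup>2 * surface_L r 2 2 u v) / (surface_W r u v)\<^sup>2"

text \<open>A generalized cylinder is taken as a point set parametrised by \<open>c t + l *\<^sub>R e\<close>, with \<open>t\<close> and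
  \<open>l\<close> ranging over open intervals (possibly bounded, so the rulings may be segments). The condition
  on the derivative of \<open>c\<close> says that the parametrisation is regular, so that the set does not
  degenerate to a line.\<close>

definition generalized_cylinder :: "(real ^ 3) set \<Rightarrow> real ^ 3 \<Rightarrow> bool" where
  "generalized_cylinder S e \<longleftrightarrow> e \<noteq> 0 \<and>
     (\<exists>c T \<Lambda>. open_interval T \<and> open_interval \<Lambda> \<and> smooth_curve_on T c \<and>
        (\<forall>t\<in>T. vector_derivative c (at t) \<notin> span {e}) \<and>
        S = {c t + l *\<^sub>R e | t l. t \<in> T \<and> l \<in> \<Lambda>})"

text \<open>A Euclidean circle lies in a plane \<open>x = const\<close> and uses the Euclidean metric in \<open>(y, z)\<close>.
  Its arcs, the full circle included, are its connected subsets with more than one point.\<close>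

definition euclidean_circle :: "real ^ 3 \<Rightarrow> real \<Rightarrow> (real ^ 3) set" where
  "euclidean_circle c \<rho> =
     {p. p $ 1 = c $ 1 \<and> sqrt ((p $ 2 - c $ 2)\<^sup>2 + (p $ 3 - c $ 3)\<^sup>2) = \<rho>}"

definition arc_of :: "(real ^ 3) set \<Rightarrow> (real ^ 3) set \<Rightarrow> bool" where
  "arc_of A C \<longleftrightarrow> A \<subseteq> C \<and> connected A \<and> (\<exists>p\<in>A. \<exists>q\<in>A. p \<noteq> q)"

end

theory Submission
  imports Defs
begin

text \<open>The mean curvature at \<open>(u, v)\<close> is \<open>g\<^sub>1' g\<^sub>2'' - g\<^sub>1'' g\<^sub>2'\<close>, the signed Euclidean curvature of
  \<open>\<beta>\<close>. With unit speed, \<open>H = H\<^sub>0\<close> becomes \<open>g\<^sub>1'' = - H\<^sub>0 g\<^sub>2'\<close> and \<open>g\<^sub>2'' = H\<^sub>0 g\<^sub>1'\<close>. So \<open>\<beta>\<close> is a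
  segment if \<open>H\<^sub>0 = 0\<close>, and otherwise \<open>(g\<^sub>1 - g\<^sub>2' / H\<^sub>0, g\<^sub>2 + g\<^sub>1' / H\<^sub>0)\<close> is a constant centre.\<close>

text \<open>No differentiability is assumed: at each point both functions have the same set of
  derivatives, so the choice operator behind \<open>deriv\<close> returns the same value, even where
  none exists. Being an equality of functions, it survives iteration of
  \<open>deriv\<close>.\<close>

lemma deriv_add_const_left: "deriv (\<lambda>s. c + g s) = deriv (g :: real \<Rightarrow> real)"
proof
  fix t
  have "(g has_field_derivative D) (at t)"
    if "((\<lambda>s. c + g s) has_field_derivative D) (at t)" for D
    using DERIV_diff[OF that DERIV_const[of c]] by simp
  moreover have "((\<lambda>s. c + g s) has_field_derivative D) (at t)"
    if "(g has_field_derivative D) (at t)" for D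
    using DERIV_add[OF DERIV_const[of c] that] by simp
  ultimately have "((\<lambda>s. c + g s) has_field_derivative D) (at t) \<longleftrightarrow> (g has_field_derivative D) (at t)" for D
    by blast
  then show "deriv (\<lambda>s. c + g s) t = deriv g t"
    by (simp add: deriv_def)
qed

lemma smooth_fun_on_id: "smooth_fun_on I (\<lambda>t. t)"
proof -
  have *: "(deriv ^^ n) (\<lambda>t::real. t) \<in> {(\<lambda>t. t), (\<lambda>_. 1), (\<lambda>_. 0)}" for n
    by (induction n) auto
  have "(deriv ^^ n) (\<lambda>t::real. t) differentiable (at x)" for n x
    using *[of n] by (elim insertE emptyE; simp only: differentiable_ident differentiable_const)
  then show ?thesis
    by (simp add: smooth_fun_on_def)
qed

lemma smooth_fun_on_add_const_left:
  assumes "smooth_fun_on I f"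
  shows "smooth_fun_on I (\<lambda>t. c + f t)"
  unfolding smooth_fun_on_def
proof (intro allI ballI)
  fix n t assume "t \<in> I"
  then have *: "(deriv ^^ n) f differentiable (at t)"
    using assms by (simp add: smooth_fun_on_def)
  show "(deriv ^^ n) (\<lambda>t. c + f t) differentiable (at t)"
  proof (cases n)
    case 0
    with * show ?thesis
      by (simp add: differentiable_add)
  next
    case (Suc k)
    with * show ?thesis
      by (simp add: deriv_add_const_left funpow_swap1)
  qed
qed

lemma smooth_fun_on_DERIV:
  assumes "smooth_fun_on I f" "t \<in> I"
  shows "(f has_real_derivative deriv f t) (at t)"
    and "(deriv f has_real_derivative deriv (deriv f) t) (at t)"
proof -
  have "(deriv ^^ 0) f differentiable (at t)" "(deriv ^^ 1) f differentiable (at t)"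
    using assms unfolding smooth_fun_on_def by blast+
  then show "(f has_real_derivative deriv f t) (at t)"
    "(deriv f has_real_derivative deriv (deriv f) t) (at t)"
    by (simp_all add: DERIV_deriv_iff_real_differentiable)
qed

lemma smooth_curve_on_graph_curve_iff:
  "smooth_curve_on I (graph_curve f1 f2) \<longleftrightarrow> smooth_fun_on I f1 \<and> smooth_fun_on I f2"
  by (auto simp: smooth_curve_on_def forall_3 graph_curve_def smooth_fun_on_id)

lemma smooth_curve_on_isotropic_curveD:
  assumes "smooth_curve_on J (isotropic_curve g1 g2)"
  shows "smooth_fun_on J g1" "smooth_fun_on J g2"
  using assms by (simp_all add: smooth_curve_on_def forall_3 isotropic_curve_def)

text \<open>This gives regularity of the cylinder: a velocity with first component 1 is never a
  multiple of an isotropic vector.\<close>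

lemma vector_derivative_graph_curve_1:
  assumes "smooth_curve_on I (graph_curve f1 f2)" "t \<in> I"
  shows "vector_derivative (graph_curve f1 f2) (at t) $ 1 = 1"
proof -
  note smooth = assms(1)[unfolded smooth_curve_on_graph_curve_iff]
  have "(graph_curve f1 f2 has_vector_derivative vector [1, deriv f1 t, deriv f2 t]) (at t)"
    unfolding has_vector_derivative_def
  proof (subst has_derivative_componentwise_within, intro ballI)
    fix b :: "real ^ 3" assume "b \<in> Basis"
    then obtain i where "b = axis i 1"
      by (auto simp: Basis_vec_def)
    then show "((\<lambda>x. graph_curve f1 f2 x \<bullet> b) has_derivative
        (\<lambda>x. (x *\<^sub>R vector [1, deriv f1 t, deriv f2 t]) \<bullet> b)) (at t)"
      using exhaust_3[of i] smooth assms(2) smooth_fun_on_DERIV(1)[of I _ t]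
      by (auto simp: inner_axis graph_curve_def has_field_derivative_def mult.commute[of _ "deriv _ _"])
  qed
  then show ?thesis
    by (simp add: vector_derivative_at)
qed

text \<open>Since \<open>x = u\<close>, all terms of \<open>H\<close> other than \<open>L\<^sub>2\<^sub>2\<close> are multiplied by \<open>x\<^sub>,\<^sub>2 = 0\<close>.\<close>

lemma mean_curvature_translation_surface:
  assumes "(deriv g1 v)\<^sup>2 + (deriv g2 v)\<^sup>2 = 1"
  shows "mean_curvature (translation_surface (graph_curve f1 f2) (isotropic_curve g1 g2)) u v
    = deriv g1 v * deriv (deriv g2) v - deriv (deriv g1) v * deriv g2 v"
proof -
  let ?r = "translation_surface (graph_curve f1 f2) (isotropic_curve g1 g2)"
  have r: "?r u v $ 1 = u" "?r u v $ 2 = f1 u + g1 v" "?r u v $ 3 = f2 u + g2 v" for u v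
    by (simp_all add: translation_surface_def graph_curve_def isotropic_curve_def)
  have x: "D1 ?r 1 1 u v = 1" "D1 ?r 1 2 u v = 0" for u v
    by (simp_all add: D1_def partial_def r)
  have yz: "D1 ?r 2 2 u v = deriv g1 v" "D1 ?r 3 2 u v = deriv g2 v" for u v
    by (simp_all add: D1_def partial_def r deriv_add_const_left)
  \<comment> \<open>The second derivative differentiates the first one along \<open>v\<close> with
    \<open>u\<close> fixed, so the values of \<open>D1\<close> are needed as functions of
    \<open>v\<close>, not just at one point.\<close>
  have D2: "D2 ?r m 2 2 u v = deriv (D1 ?r m 2 u) v" for m
    by (simp add: D2_def D1_def partial_def)
  have D2: "D2 ?r 1 2 2 u v = 0" "D2 ?r 2 2 2 u v = deriv (deriv g1) v"
    "D2 ?r 3 2 2 u v = deriv (deriv g2) v"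
    by (simp_all add: D2 ext[of "D1 ?r 1 2 u" "\<lambda>_. 0", OF x(2)]
        ext[of "D1 ?r 2 2 u", OF yz(1)] ext[of "D1 ?r 3 2 u", OF yz(2)])
  have W: "surface_W ?r u v = 1"
    using assms by (simp add: surface_W_def x yz add.commute)
  \<comment> \<open>The index chosen by \<open>SOME\<close> in \<open>surface_L\<close> may be
    replaced by 1, because the first partial derivative of \<open>x\<close> is 1.\<close>
  have "mean_curvature ?r u v = surface_L_wrt 1 ?r 2 2 u v"
    by (simp add: mean_curvature_def x W surface_L_eq[of ?r 1])
  then show ?thesis
    by (simp add: surface_L_wrt_def surface_N_def x yz D2 W inner_vec_def sum_3)
qed

text \<open>These are the Frenet equations of a plane unit-speed curve: the acceleration is
  orthogonal to the unit tangent, and its component along the rotated tangent is the signed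
  curvature \<open>k\<close>.\<close>

lemma unit_speed_ode:
  assumes "open J" "v \<in> J" "smooth_fun_on J g1" "smooth_fun_on J g2"
    and unit: "\<And>w. w \<in> J \<Longrightarrow> (deriv g1 w)\<^sup>2 + (deriv g2 w)\<^sup>2 = 1"
    and curv: "deriv g1 v * deriv (deriv g2) v - deriv (deriv g1) v * deriv g2 v = k"
  shows "deriv (deriv g1) v = - k * deriv g2 v" "deriv (deriv g2) v = k * deriv g1 v"
proof -
  let ?a = "deriv g1 v" and ?b = "deriv g2 v"
  let ?A = "deriv (deriv g1) v" and ?B = "deriv (deriv g2) v"
  have "((\<lambda>w. (deriv g1 w)\<^sup>2 + (deriv g2 w)\<^sup>2) has_real_derivative 2 * (?a * ?A + ?b * ?B)) (at v)"
    by (rule derivative_eq_intros smooth_fun_on_DERIV(2) assms refl)+ (simp add: algebra_simps)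
  \<comment> \<open>The speed is known to be 1 only on \<open>J\<close>; openness makes it constant
    near \<open>v\<close>, which is enough for the derivative.\<close>
  moreover have "((\<lambda>w. (deriv g1 w)\<^sup>2 + (deriv g2 w)\<^sup>2) has_real_derivative 0) (at v)"
    by (rule DERIV_cong_ev[THEN iffD2, OF refl _ refl DERIV_const[of 1]])
      (use eventually_nhds_in_open[OF assms(1,2)] unit in \<open>auto elim: eventually_mono\<close>)
  ultimately have orth: "?a * ?A + ?b * ?B = 0"
    using DERIV_unique by fastforce
  \<comment> \<open>Expand the acceleration in the orthonormal frame \<open>(?a, ?b)\<close>,
    \<open>(- ?b, ?a)\<close>: the tangential coefficient is 0 and the normal one is
    \<open>k\<close>.\<close>
  have "?A = ?A * (?a\<^sup>2 + ?b\<^sup>2)"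
    by (simp add: unit[OF assms(2)])
  also have "\<dots> = ?a * (?a * ?A + ?b * ?B) - (?a * ?B - ?A * ?b) * ?b"
    by (simp add: algebra_simps power2_eq_square)
  also have "\<dots> = - k * ?b"
    by (simp add: orth curv)
  finally show "?A = - k * ?b" .
  have "?B = ?B * (?a\<^sup>2 + ?b\<^sup>2)"
    by (simp add: unit[OF assms(2)])
  also have "\<dots> = ?b * (?a * ?A + ?b * ?B) + (?a * ?B - ?A * ?b) * ?a"
    by (simp add: algebra_simps power2_eq_square)
  also have "\<dots> = k * ?a"
    by (simp add: orth curv)
  finally show "?B = k * ?a" .
qed

lemma DERIV_zero_interval_const:
  fixes f :: "real \<Rightarrow> real"
  assumes "is_interval J" "\<And>x. x \<in> J \<Longrightarrow> (f has_real_derivative 0) (at x)"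
  obtains c where "\<And>x. x \<in> J \<Longrightarrow> f x = c"
  using assms has_field_derivative_zero_constant[of J f] DERIV_subset[of f 0 _ UNIV]
  by (metis is_interval_convex subset_UNIV)

theorem theorem4p2:
  fixes f1 f2 g1 g2 :: "real \<Rightarrow> real" and I J :: "real set" and H0 :: real
  assumes "open_interval I" and "open_interval J"
    and "smooth_curve_on I (graph_curve f1 f2)"
    and "space_curve_on I f1 f2"
    and "smooth_curve_on J (isotropic_curve g1 g2)"
    and "\<forall>v\<in>J. (deriv g1 v)\<^sup>2 + (deriv g2 v)\<^sup>2 = 1"
    and "\<forall>u\<in>I. \<forall>v\<in>J.
           mean_curvature (translation_surface (graph_curve f1 f2) (isotropic_curve g1 g2)) u v = H0"
  shows "(H0 = 0 \<and>
          (\<exists>e. isotropic e \<and>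
             generalized_cylinder
               {translation_surface (graph_curve f1 f2) (isotropic_curve g1 g2) u v | u v.
                  u \<in> I \<and> v \<in> J} e))
       \<or> (H0 \<noteq> 0 \<and>
          (\<exists>c. arc_of (isotropic_curve g1 g2 ` J) (euclidean_circle c (1 / \<bar>H0\<bar>))))"
proof -
  have J: "open J" "is_interval J" "J \<noteq> {}" and "I \<noteq> {}"
    using assms(1,2) by (auto simp: open_interval_def)
  note g = smooth_curve_on_isotropic_curveD[OF assms(5)]
  note unit = assms(6)[rule_format]
  \<comment> \<open>The curvature expression does not involve \<open>u\<close>, so a single point of
    \<open>I\<close> suffices.\<close>
  have curv: "deriv g1 v * deriv (deriv g2) v - deriv (deriv g1) v * deriv g2 v = H0"
    if "v \<in> J" for v
    using assms(7) \<open>I \<noteq> {}\<close> that mean_curvature_translation_surface[OF unit] by fastforce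
  note dg1 = smooth_fun_on_DERIV[OF g(1)] and dg2 = smooth_fun_on_DERIV[OF g(2)]
  note ode = unit_speed_ode[OF J(1) _ g unit curv]
  show ?thesis
  proof (cases "H0 = 0")
    case True
    obtain a where a: "\<And>v. v \<in> J \<Longrightarrow> deriv g1 v = a"
      using DERIV_zero_interval_const[OF J(2), of "deriv g1"] dg1(2) ode True
      by (metis minus_zero mult_zero_left)
    obtain b where b: "\<And>v. v \<in> J \<Longrightarrow> deriv g2 v = b"
      using DERIV_zero_interval_const[OF J(2), of "deriv g2"] dg2(2) ode True
      by (metis mult_zero_left)
    \<comment> \<open>Removing the linear part leaves the constants \<open>p\<close> and
      \<open>q\<close>, so the isotropic curve is \<open>(0, p, q)\<close> plus \<open>v\<close>
      times \<open>(0, a, b)\<close>.\<close>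
    have const: "((\<lambda>v. g1 v - v * a) has_real_derivative 0) (at v)"
      "((\<lambda>v. g2 v - v * b) has_real_derivative 0) (at v)" if "v \<in> J" for v
      using DERIV_diff[OF dg1(1)[OF that] DERIV_cmult_Id[of a]] DERIV_diff[OF dg2(1)[OF that] DERIV_cmult_Id[of b]]
      by (simp_all add: a b that mult.commute)
    obtain p q where pq: "g1 v - v * a = p" "g2 v - v * b = q" if "v \<in> J" for v
      using DERIV_zero_interval_const[OF J(2) const(1)] DERIV_zero_interval_const[OF J(2) const(2)]
      by (metis (lifting))
    define e :: "real ^ 3" where "e = vector [0, a, b]"
    \<comment> \<open>The directrix is the space curve shifted by \<open>(0, p, q)\<close>;
      \<open>v\<close> itself becomes the ruling parameter, so the parameter intervals of the
      cylinder are \<open>I\<close> and \<open>J\<close>.\<close>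
    define c where "c = graph_curve (\<lambda>u. p + f1 u) (\<lambda>u. q + f2 u)"
    have "isotropic e"
      by (simp add: isotropic_def e_def)
    have "a\<^sup>2 + b\<^sup>2 = 1"
      using unit a b J(3) by fastforce
    then have "e \<noteq> 0"
      by (auto simp: e_def vec_eq_iff forall_3)
    have c: "smooth_curve_on I c"
      using assms(3) by (simp add: c_def smooth_curve_on_graph_curve_iff smooth_fun_on_add_const_left)
    have "vector_derivative c (at t) \<notin> span {e}" if "t \<in> I" for t
    proof
      assume "vector_derivative c (at t) \<in> span {e}"
      then have "vector_derivative c (at t) $ 1 = 0"
        by (auto simp: span_singleton e_def)
      then show False
        using vector_derivative_graph_curve_1 c that by (simp add: c_def)
    qed
    moreover have "translation_surface (graph_curve f1 f2) (isotropic_curve g1 g2) u v = c u + v *\<^sub>R e"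
      if "v \<in> J" for u v
      using pq[OF that]
      by (simp add: translation_surface_def graph_curve_def isotropic_curve_def c_def e_def
          vec_eq_iff forall_3)
    then have "{translation_surface (graph_curve f1 f2) (isotropic_curve g1 g2) u v | u v. u \<in> I \<and> v \<in> J}
      = {c u + v *\<^sub>R e | u v. u \<in> I \<and> v \<in> J}"
      by metis
    ultimately show ?thesis
      using True \<open>isotropic e\<close> \<open>e \<noteq> 0\<close> c assms(1,2) unfolding generalized_cylinder_def by blast
  next
    case False
    \<comment> \<open>These are the coordinates of the centre of curvature, the point of the curve
      plus \<open>1 / H0\<close> times the normal \<open>(- deriv g2 v, deriv g1 v)\<close>. By
      \<open>ode\<close> the evolute is stationary.\<close>
    have const: "((\<lambda>v. g1 v - deriv g2 v / H0) has_real_derivative 0) (at v)"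
      "((\<lambda>v. g2 v + deriv g1 v / H0) has_real_derivative 0) (at v)" if "v \<in> J" for v
      using DERIV_diff[OF dg1(1)[OF that] DERIV_cdivide[OF dg2(2)[OF that], of H0]]
        DERIV_add[OF dg2(1)[OF that] DERIV_cdivide[OF dg1(2)[OF that], of H0]]
      by (simp_all add: ode that False)
    obtain p q where pq: "g1 v - deriv g2 v / H0 = p" "g2 v + deriv g1 v / H0 = q" if "v \<in> J" for v
      using DERIV_zero_interval_const[OF J(2) const(1)] DERIV_zero_interval_const[OF J(2) const(2)]
      by (metis (lifting))
    let ?c = "vector [0, p, q] :: real ^ 3" and ?\<beta> = "isotropic_curve g1 g2"
    \<comment> \<open>The vector from the centre is a rotated unit tangent divided by
      \<open>H0\<close>; the absolute value comes from the root of the square of \<open>H0\<close>,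
      whose sign only records orientation.\<close>
    have "sqrt ((g1 v - p)\<^sup>2 + (g2 v - q)\<^sup>2) = 1 / \<bar>H0\<bar>" if "v \<in> J" for v
    proof -
      have "g1 v - p = deriv g2 v / H0" "g2 v - q = - (deriv g1 v / H0)"
        using pq[OF that] by linarith+
      then have "(g1 v - p)\<^sup>2 + (g2 v - q)\<^sup>2 = ((deriv g1 v)\<^sup>2 + (deriv g2 v)\<^sup>2) / H0\<^sup>2"
        by (simp add: power_divide add_divide_distrib)
      then show ?thesis
        by (simp add: unit[OF that] real_sqrt_divide)
    qed
    then have "?\<beta> ` J \<subseteq> euclidean_circle ?c (1 / \<bar>H0\<bar>)"
      by (auto simp: euclidean_circle_def isotropic_curve_def)
    moreover have "connected (?\<beta> ` J)"
    proof (rule connected_continuous_image)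
      have "continuous_on J g1" "continuous_on J g2"
        using smooth_fun_on_DERIV(1) g by (blast intro: DERIV_atLeastAtMost_imp_continuous_on DERIV_isCont continuous_at_imp_continuous_on)+
      then have "continuous_on J (\<lambda>v. ?\<beta> v $ i)" for i
        using exhaust_3[of i] by (auto simp: isotropic_curve_def)
      then have "continuous_on J (\<lambda>v. \<chi> i. ?\<beta> v $ i)"
        by (rule continuous_on_vec_lambda)
      then show "continuous_on J ?\<beta>"
        by simp
      show "connected J"
        using J(2) by (simp add: is_interval_connected)
    qed
    \<comment> \<open>If the image were a single point, both coordinates would be constant near a
      point of the open set \<open>J\<close>, and the speed there would be 0 instead of 1.\<close>
    moreover have "\<exists>p\<in>?\<beta> ` J. \<exists>q\<in>?\<beta> ` J. p \<noteq> q"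
    proof (rule ccontr)
      assume const: "\<not> ?thesis"
      obtain v where v: "v \<in> J"
        using J(3) by blast
      have "?\<beta> w $ i = ?\<beta> v $ i" if "w \<in> J" for w i
        using const v that by (metis imageI)
      from this[of _ 2] this[of _ 3] have *: "g1 w = g1 v" "g2 w = g2 v" if "w \<in> J" for w
        using that by (simp_all add: isotropic_curve_def)
      have "deriv g1 v = deriv (\<lambda>_. g1 v) v" "deriv g2 v = deriv (\<lambda>_. g2 v) v"
        by (rule deriv_cong_ev; use eventually_nhds_in_open[OF J(1) v] * in \<open>auto elim: eventually_mono\<close>)+
      then show False
        using unit[OF v] by simp
    qed
    ultimately show ?thesis
      using False unfolding arc_of_def by blast
  qed
qed

end
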